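(* Let $m,n\ge 1$ be integers and let $L_{m,n}$ be the $(m,n)$-lollipop graph. Then $$\mathcal{L}(L_{m,n})=(m-1)!\left(\binom{m+n}{n+1}+\sum_{k=0}^{n-1}\binom{m+n-1}{k+m}\right).$$
   Context: Let $H$ be a finite, connected, undirected graph with vertex set $V$. A random walk labeling of $H$ is a labeling of $V$ obtainable by the following process: (1) set $i=1$, choose any $v\in V$ and label $v$ with $i$; (2) as long as there are unlabeled vertices, choose a vertex $w$ adjacent to the current vertex $v$ and replace $v$ by $w$; if this new $v$ is not labeled, increase $i$ by $1$ and label $v$ with $i$. The number of different random walk labelings of $H$ is denoted by $\mathcal{L}(H)$. The $(m,n)$-lollipop graph $L_{m,n}$ is obtained from the disjoint union of the complete graph $K_m$ and the path graph $P_n$ on $n$ vertices by adding a single edge (a bridge) between a vertex of $K_m$ and an end vertex of $P_n$. *)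

theory Defs
  imports "Graph_Theory.Graph_Theory"
begin

text \<open>
  Undirected simple graphs are symmetric loop-free digraphs without parallel arcs, i.e.\ values
  of type \<^typ>\<open>'a pair_pre_digraph\<close> that satisfy \<^locale>\<open>pair_graph\<close>; every edge is
  represented by its two orientations.

  A state \<open>(v, i, l)\<close> of the labeling process consists of the current vertex, the largest
  label used so far, and the partial labeling built so far, where \<^term>\<open>l x = None\<close> means
  that \<open>x\<close> is still unlabeled.
\<close>

inductive rw_process :: "'a pair_pre_digraph \<Rightarrow> 'a \<Rightarrow> nat \<Rightarrow> ('a \<rightharpoonup> nat) \<Rightarrow> bool"
  for H :: "'a pair_pre_digraph" where
  start: "v \<in> pverts H \<Longrightarrow> rw_process H v 1 [v \<mapsto> 1]"
| move_new: "\<lbrakk>rw_process H v i l; \<exists>x\<in>pverts H. l x = None; (v, w) \<in> parcs H; l w = None\<rbrakk>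
    \<Longrightarrow> rw_process H w (i + 1) (l(w \<mapsto> i + 1))"
| move_old: "\<lbrakk>rw_process H v i l; \<exists>x\<in>pverts H. l x = None; (v, w) \<in> parcs H; l w \<noteq> None\<rbrakk>
    \<Longrightarrow> rw_process H w i l"

definition random_walk_labelings :: "'a pair_pre_digraph \<Rightarrow> ('a \<rightharpoonup> nat) set" where
  "random_walk_labelings H = {l. dom l = pverts H \<and> (\<exists>v i. rw_process H v i l)}"

definition num_rw_labelings :: "'a pair_pre_digraph \<Rightarrow> nat" (\<open>\<L>\<close>) where
  "\<L> H = card (random_walk_labelings H)"

definition complete_graph :: "nat \<Rightarrow> nat pair_pre_digraph" where
  "complete_graph m = \<lparr>pverts = {..<m}, parcs = {(x, y). x < m \<and> y < m \<and> x \<noteq> y}\<rparr>"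

definition path_graph :: "nat \<Rightarrow> nat pair_pre_digraph" where
  "path_graph n = \<lparr>pverts = {..<n}, parcs = {(x, y). x < n \<and> y < n \<and> (y = x + 1 \<or> x = y + 1)}\<rparr>"

text \<open>For \<open>n = 1\<close> the only vertex of the path is its end vertex.\<close>

definition path_ends :: "nat \<Rightarrow> nat set" where
  "path_ends n = {0, n - 1}"

definition disjoint_union ::
  "'a pair_pre_digraph \<Rightarrow> 'b pair_pre_digraph \<Rightarrow> ('a + 'b) pair_pre_digraph" where
  "disjoint_union G H = \<lparr>pverts = pverts G <+> pverts H,
     parcs = map_prod Inl Inl ` parcs G \<union> map_prod Inr Inr ` parcs H\<rparr>"

definition add_edge :: "'a \<Rightarrow> 'a \<Rightarrow> 'a pair_pre_digraph \<Rightarrow> 'a pair_pre_digraph" where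
  "add_edge x y G = \<lparr>pverts = pverts G, parcs = parcs G \<union> {(x, y), (y, x)}\<rparr>"

text \<open>
  The arguments \<open>a\<close> and \<open>b\<close> are the ends of the bridge in the complete graph and in the
  path, to be chosen as \<^term>\<open>a \<in> pverts (complete_graph m)\<close> and \<^term>\<open>b \<in> path_ends n\<close>.
\<close>

definition lollipop :: "nat \<Rightarrow> nat \<Rightarrow> nat \<Rightarrow> nat \<Rightarrow> (nat + nat) pair_pre_digraph" where
  "lollipop m n a b = add_edge (Inl a) (Inr b) (disjoint_union (complete_graph m) (path_graph n))"

lemma complete_digraph_complete_graph: "complete_digraph m (with_proj (complete_graph m))"
  by (auto simp: complete_digraph_pair_def complete_graph_def)

lemma pair_graph_lollipop:
  assumes "a \<in> pverts (complete_graph m)" "b \<in> path_ends n" "n \<ge> 1"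
  shows "pair_graph (lollipop m n a b)"
proof -
  have "finite (parcs (complete_graph m))"
    by (rule finite_subset[of _ "{..<m} \<times> {..<m}"]) (auto simp: complete_graph_def)
  moreover have "finite (parcs (path_graph n))"
    by (rule finite_subset[of _ "{..<n} \<times> {..<n}"]) (auto simp: path_graph_def)
  ultimately have fin: "finite (parcs (lollipop m n a b))"
    by (simp add: lollipop_def add_edge_def disjoint_union_def)
  have "sym (parcs (lollipop m n a b))"
    by (rule symI)
      (auto simp: lollipop_def add_edge_def disjoint_union_def complete_graph_def path_graph_def
        image_iff)
  then show ?thesis
    using assms fin
    by unfold_locales
      (auto simp: lollipop_def add_edge_def disjoint_union_def complete_graph_def path_graph_def
        path_ends_def symmetric_def)
qed

lemma connected_lollipop:
  assumes a: "a \<in> pverts (complete_graph m)" and b: "b \<in> path_ends n" and n: "n \<ge> 1"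
  shows "connected (with_proj (lollipop m n a b))"
proof -
  let ?G = "lollipop m n a b"
  interpret pair_graph ?G
    by (rule pair_graph_lollipop[OF a b n])
  have am: "a < m"
    using a by (simp add: complete_graph_def)
  have bn: "b < n"
    using b n by (auto simp: path_ends_def)
  have sym: "(y, x) \<in> parcs ?G" if "(x, y) \<in> parcs ?G" for x y
    using sym_arcs that by (auto simp: symmetric_def dest: symD)
  have mk: "mk_symmetric (with_proj ?G) = ?G"
    by (rule pair_pre_digraph.equality) (auto simp: mk_symmetric_def intro: sym)
  have verts: "pverts ?G = Inl ` {..<m} \<union> Inr ` {..<n}"
    by (auto simp: lollipop_def add_edge_def disjoint_union_def complete_graph_def path_graph_def)
  have path_arc: "(Inr k, Inr (Suc k)) \<in> (parcs ?G)\<^sup>*" if "Suc k < n" for k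
    using that by (intro r_into_rtrancl)
      (auto simp: lollipop_def add_edge_def disjoint_union_def path_graph_def image_iff)
  have symcl: "(y, x) \<in> (parcs ?G)\<^sup>*" if "(x, y) \<in> (parcs ?G)\<^sup>*" for x y
    using that sym_rtrancl[of "parcs ?G"] sym by (meson symD symI)
  have path: "(Inr 0, Inr k) \<in> (parcs ?G)\<^sup>*" if "k < n" for k
    using that
  proof (induction k)
    case (Suc k)
    then show ?case
      using path_arc[of k] by (meson Suc_lessD rtrancl_trans)
  qed simp
  have bridge: "(Inl a, Inr b) \<in> (parcs ?G)\<^sup>*"
    by (intro r_into_rtrancl) (simp add: lollipop_def add_edge_def)
  have complete: "(Inl a, Inl x) \<in> (parcs ?G)\<^sup>*" if "x < m" for x
  proof (cases "x = a")
    case False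
    then show ?thesis
      using that am by (intro r_into_rtrancl)
        (auto simp: lollipop_def add_edge_def disjoint_union_def complete_graph_def image_iff)
  qed simp
  have root: "(Inl a, z) \<in> (parcs ?G)\<^sup>*" if "z \<in> pverts ?G" for z
    using that complete bridge path symcl[OF path[OF bn]]
    by (auto simp: verts intro: rtrancl_trans)
  have "(y, z) \<in> (parcs ?G)\<^sup>*" if "y \<in> pverts ?G" "z \<in> pverts ?G" for y z
    using symcl[OF root[OF that(1)]] root[OF that(2)] by (rule rtrancl_trans)
  moreover have "pverts ?G \<noteq> {}"
    using am by (auto simp: verts)
  ultimately have "strongly_connected (with_proj ?G)"
    by (auto simp: strongly_connected_def reachable_conv)
  then show ?thesis
    by (simp add: connected_def mk)
qed

end

theory Submission
  imports Defs
begin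

text \<open>
  Since the walk may wander freely inside the labeled set, which stays connected, a random walk
  labeling is the same as an ordering of the vertices in which every vertex but the first is
  adjacent to an earlier one. The number of ways to complete a partial ordering depends only on
  the set \<open>S\<close> of vertices already used, and it is the sum of the numbers for
  \<open>insert w S\<close> over the vertices \<open>w\<close> adjacent to \<open>S\<close>. In a
  lollipop the connected sets \<open>S\<close> are of three kinds (containing the bridge vertex \<open>a\<close> of the
  clique, a part of the clique without \<open>a\<close>, a segment of the path), and on each kind the recursion
  is Pascal's rule.
\<close>

section \<open>Random walk labelings as growth sequences\<close>

text \<open>The vertices that may come next. The case \<open>S = {}\<close> admits every vertex, so
  the free choice of the start obeys the same recursion as all later choices.\<close>

definition frontier :: "'a pair_pre_digraph \<Rightarrow> 'a set \<Rightarrow> 'a set" where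
  "frontier H S = {w \<in> pverts H - S. S = {} \<or> (\<exists>u\<in>S. (u, w) \<in> parcs H)}"

fun growth_seq :: "'a pair_pre_digraph \<Rightarrow> 'a set \<Rightarrow> 'a list \<Rightarrow> bool" where
  "growth_seq H S [] \<longleftrightarrow> True"
| "growth_seq H S (w # ws) \<longleftrightarrow> w \<in> frontier H S \<and> growth_seq H (insert w S) ws"

definition completions :: "'a pair_pre_digraph \<Rightarrow> 'a set \<Rightarrow> 'a list set" where
  "completions H S = {ws. growth_seq H S ws \<and> S \<union> set ws = pverts H}"

definition enum_labeling :: "'a list \<Rightarrow> 'a \<rightharpoonup> nat" where
  "enum_labeling xs = map_of (zip xs [1..<Suc (length xs)])"

lemma frontier_subset: "frontier H S \<subseteq> pverts H - S"
  by (auto simp: frontier_def)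

text \<open>\<open>growth_seq\<close> unfolds at the front, while the labeling process extends an
  ordering at its end.\<close>

lemma growth_seq_snoc:
  "growth_seq H S (ws @ [w]) \<longleftrightarrow> growth_seq H S ws \<and> w \<in> frontier H (S \<union> set ws)"
  by (induction ws arbitrary: S) (auto simp: Un_commute insert_commute)

lemma growth_seq_distinct:
  "growth_seq H S ws \<Longrightarrow> distinct ws \<and> set ws \<subseteq> pverts H - S"
  by (induction ws arbitrary: S) (use frontier_subset in fastforce)+

lemma finite_completions:
  assumes "finite (pverts H)"
  shows "finite (completions H S)"
  by (rule finite_subset[OF _ finite_subset_distinct[OF assms]])
    (auto simp: completions_def dest: growth_seq_distinct)

lemma card_completions_full: "card (completions H (pverts H)) = 1"
proof -
  have "completions H (pverts H) = {[]}"
    by (auto simp: completions_def dest: growth_seq_distinct)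
  then show ?thesis by simp
qed

text \<open>Since \<open>S\<close> is not the whole vertex set, no completion is empty, so each
  splits uniquely into its first vertex and a completion of the enlarged set.\<close>

lemma card_completions_step:
  assumes fin: "finite (pverts H)" and "S \<noteq> pverts H"
  shows "card (completions H S) = (\<Sum>w\<in>frontier H S. card (completions H (insert w S)))"
proof -
  have eq: "completions H S = (\<Union>w\<in>frontier H S. (#) w ` completions H (insert w S))"
  proof (intro set_eqI)
    fix ws
    show "ws \<in> completions H S \<longleftrightarrow> ws \<in> (\<Union>w\<in>frontier H S. (#) w ` completions H (insert w S))"
      using assms(2) by (cases ws) (auto simp: completions_def)
  qed
  have "finite (frontier H S)"
    using fin frontier_subset by (metis finite_Diff finite_subset)
  then have "card (completions H S)
      = (\<Sum>w\<in>frontier H S. card ((#) w ` completions H (insert w S)))"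
    unfolding eq by (rule card_UN_disjoint) (auto intro: finite_completions[OF fin])
  then show ?thesis
    by (simp add: card_image)
qed

section \<open>Labelings as orderings: the encoding, then the equivalence with the walk
  process\<close>

lemma dom_enum_labeling: "dom (enum_labeling xs) = set xs"
  by (simp add: enum_labeling_def del: upt_Suc)

lemma enum_labeling_snoc:
  assumes "w \<notin> set xs"
  shows "enum_labeling (xs @ [w]) = (enum_labeling xs)(w \<mapsto> length xs + 1)"
proof -
  have "[1..<Suc (length (xs @ [w]))] = [1..<Suc (length xs)] @ [length xs + 1]"
    by simp
  \<comment> \<open>In \<open>map_of\<close> earlier pairs take precedence, so the appended pair
    becomes the overridden operand of \<open>++\<close>; freshness of \<open>w\<close> makes this
    agree with an update.\<close>
  then have "enum_labeling (xs @ [w]) = [w \<mapsto> length xs + 1] ++ enum_labeling xs"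
    unfolding enum_labeling_def by (simp add: fun_eq_iff map_add_def del: upt_Suc)
  moreover have "w \<notin> dom (enum_labeling xs)"
    using assms by (simp add: dom_enum_labeling)
  ultimately show ?thesis
    by (auto simp: map_add_def fun_eq_iff domIff split: option.split)
qed

lemma enum_labeling_singleton: "enum_labeling [w] = [w \<mapsto> 1]"
  by (simp add: enum_labeling_def fun_eq_iff)

lemma enum_labeling_nth:
  assumes "distinct xs" "k < length xs"
  shows "enum_labeling xs (xs ! k) = Some (k + 1)"
  using assms by (simp add: enum_labeling_def map_of_zip_nth del: upt_Suc)

text \<open>The vertex labeled \<open>k + 1\<close> is the one at position \<open>k\<close>, so a
  distinct list can be read back. Counting labelings thus becomes counting lists.\<close>

lemma inj_on_enum_labeling: "inj_on enum_labeling {xs. distinct xs}"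
proof (rule inj_onI; clarsimp)
  fix xs ys :: "'a list"
  assume d: "distinct xs" "distinct ys" and eq: "enum_labeling xs = enum_labeling ys"
  have s: "set xs = set ys"
    using eq dom_enum_labeling by metis
  show "xs = ys"
  proof (rule nth_equalityI)
    show "length xs = length ys"
      using d s by (metis distinct_card)
    fix k assume k: "k < length xs"
    then obtain j where j: "j < length ys" "ys ! j = xs ! k"
      using s by (metis in_set_conv_nth)
    then have "j = k"
      using enum_labeling_nth[OF d(1) k] enum_labeling_nth[OF d(2) j(1)] eq by simp
    then show "xs ! k = ys ! k" using j by simp
  qed
qed

text \<open>\<open>move_new\<close> appends a vertex and \<open>move_old\<close> leaves the list
  alone. The invariant \<open>v \<in> set xs\<close> puts a newly labeled neighbour of
  \<open>v\<close> into the frontier.\<close>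

lemma rw_process_growth_seq:
  assumes "rw_process H v i l" "parcs H \<subseteq> pverts H \<times> pverts H"
  shows "\<exists>xs. growth_seq H {} xs \<and> l = enum_labeling xs \<and> length xs = i \<and> v \<in> set xs"
  using assms
proof (induction rule: rw_process.induct)
  case (start v)
  then show ?case
    by (intro exI[of _ "[v]"]) (auto simp: frontier_def enum_labeling_singleton)
next
  case (move_new v i l w)
  then obtain xs where xs: "growth_seq H {} xs" "l = enum_labeling xs" "length xs = i" "v \<in> set xs"
    by blast
  have "w \<notin> set xs"
    using move_new.hyps(4) xs(2) dom_enum_labeling[of xs] by (auto simp: domIff)
  then show ?case
    using xs move_new
    by (intro exI[of _ "xs @ [w]"]) (auto simp: growth_seq_snoc enum_labeling_snoc frontier_def)
next
  case (move_old v i l w)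
  then show ?case
    using dom_enum_labeling by (metis domIff)
qed

text \<open>Moves within the labeled set are \<open>move_old\<close> steps, which change neither
  counter nor labeling; the process permits them while some vertex is unlabeled.\<close>

lemma rw_process_walk:
  assumes "rw_process H x i l" "\<exists>z\<in>pverts H. l z = None"
    and "(x, y) \<in> (parcs H \<inter> dom l \<times> dom l)\<^sup>*"
  shows "rw_process H y i l"
  using assms(3,1)
  by (induction rule: rtrancl_induct) (auto intro: rw_process.move_old assms(2))

text \<open>The last vertex has an earlier neighbour \<open>u\<close>, and any path to or from it
  can be routed through \<open>u\<close>, with symmetry giving both directions.\<close>

lemma growth_seq_connected:
  assumes "growth_seq H {} xs" "sym (parcs H)" "x \<in> set xs" "y \<in> set xs"
  shows "(x, y) \<in> (parcs H \<inter> set xs \<times> set xs)\<^sup>*"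
  using assms
proof (induction xs arbitrary: x y rule: rev_induct)
  case (snoc w xs)
  let ?R = "parcs H \<inter> set (xs @ [w]) \<times> set (xs @ [w])"
  have mono: "(parcs H \<inter> set xs \<times> set xs)\<^sup>* \<subseteq> ?R\<^sup>*"
    by (rule rtrancl_mono) auto
  have g: "growth_seq H {} xs" and f: "w \<in> frontier H (set xs)"
    using snoc.prems(1) by (auto simp: growth_seq_snoc)
  show ?case
  proof (cases "xs = []")
    case True
    then show ?thesis using snoc.prems by simp
  next
    case False
    then obtain u where u: "u \<in> set xs" "(u, w) \<in> parcs H"
      using f by (auto simp: frontier_def)
    then have uw: "(u, w) \<in> ?R" "(w, u) \<in> ?R"
      using snoc.prems(2) by (auto dest: symD)
    have old: "(x, y) \<in> ?R\<^sup>*" if "x \<in> set xs" "y \<in> set xs" for x y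
      using snoc.IH[OF g snoc.prems(2) that] mono by blast
    have "(x, u) \<in> ?R\<^sup>*"
      using snoc.prems(3) old u uw by auto
    moreover have "(u, y) \<in> ?R\<^sup>*"
      using snoc.prems(4) old u uw by auto
    ultimately show ?thesis by (rule rtrancl_trans)
  qed
qed simp

text \<open>Before each new vertex \<open>w\<close>, the walk returns inside the labeled set to an
  earlier neighbour of \<open>w\<close> and then crosses to \<open>w\<close>.\<close>

lemma growth_seq_rw_process:
  assumes "growth_seq H {} xs" "sym (parcs H)" "xs \<noteq> []"
  shows "rw_process H (last xs) (length xs) (enum_labeling xs)"
  using assms
proof (induction xs rule: rev_induct)
  case (snoc w xs)
  have g: "growth_seq H {} xs" and f: "w \<in> frontier H (set xs)"
    using snoc.prems(1) by (auto simp: growth_seq_snoc)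
  have w: "w \<in> pverts H" "w \<notin> set xs"
    using f by (auto simp: frontier_def)
  show ?case
  proof (cases "xs = []")
    case True
    then show ?thesis
      using rw_process.start[OF w(1), folded enum_labeling_singleton] by simp
  next
    case False
    then obtain u where u: "u \<in> set xs" "(u, w) \<in> parcs H"
      using f by (auto simp: frontier_def)
    have w_None: "enum_labeling xs w = None"
      using w(2) dom_enum_labeling by (metis domIff)
    have "rw_process H (last xs) (length xs) (enum_labeling xs)"
      using snoc.IH g snoc.prems(2) False by blast
    moreover have "(last xs, u) \<in> (parcs H \<inter> set xs \<times> set xs)\<^sup>*"
      using growth_seq_connected[OF g snoc.prems(2) last_in_set[OF False] u(1)] .
    ultimately have "rw_process H u (length xs) (enum_labeling xs)"
      using rw_process_walk w(1) w_None dom_enum_labeling by metis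
    then have "rw_process H w (length xs + 1) ((enum_labeling xs)(w \<mapsto> length xs + 1))"
      using w(1) w_None u(2) by (blast intro: rw_process.move_new)
    then show ?thesis
      unfolding enum_labeling_snoc[OF w(2)] last_snoc length_append_singleton Suc_eq_plus1 .
  qed
qed simp

text \<open>Nonemptiness matters: without vertices the process cannot start, yet the empty list
  would count as a completion.\<close>

theorem num_rw_labelings_eq_card_completions:
  assumes "parcs H \<subseteq> pverts H \<times> pverts H" "sym (parcs H)" "pverts H \<noteq> {}"
  shows "\<L> H = card (completions H {})"
proof -
  have "random_walk_labelings H = enum_labeling ` completions H {}"
  proof (intro equalityI subsetI)
    fix l assume "l \<in> random_walk_labelings H"
    then show "l \<in> enum_labeling ` completions H {}"
      using rw_process_growth_seq[OF _ assms(1)]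
      by (fastforce simp: random_walk_labelings_def completions_def dom_enum_labeling)
  next
    fix l assume "l \<in> enum_labeling ` completions H {}"
    then show "l \<in> random_walk_labelings H"
      using growth_seq_rw_process[OF _ assms(2)] assms(3)
      by (fastforce simp: random_walk_labelings_def completions_def dom_enum_labeling)
  qed
  moreover have "inj_on enum_labeling (completions H {})"
    by (rule inj_on_subset[OF inj_on_enum_labeling])
      (auto simp: completions_def dest: growth_seq_distinct)
  ultimately show ?thesis
    by (simp add: num_rw_labelings_def card_image)
qed

section \<open>Counting in a lollipop\<close>

text \<open>The path is \<open>p 0, \<dots>, p (n - 1)\<close>, numbered from the bridge, so that both choices of the end
  vertex \<open>b\<close> are covered.\<close>

locale lollipop_graph =
  fixes G :: "'a pair_pre_digraph" and K :: "'a set" and a :: 'a and p :: "nat \<Rightarrow> 'a" and n :: nat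
  assumes finite_K: "finite K" and a_in_K: "a \<in> K" and n_pos: "n > 0"
    and inj_p: "inj_on p {..<n}" and p_notin_K: "\<And>i. i < n \<Longrightarrow> p i \<notin> K"
    and verts: "pverts G = K \<union> p ` {..<n}"
    and arcs: "(x, y) \<in> parcs G \<longleftrightarrow> x \<in> K \<and> y \<in> K \<and> x \<noteq> y
      \<or> (\<exists>i j. i < n \<and> j < n \<and> (j = i + 1 \<or> i = j + 1) \<and> x = p i \<and> y = p j)
      \<or> (x, y) = (a, p 0) \<or> (x, y) = (p 0, a)"
begin

lemma finite_verts: "finite (pverts G)"
  using finite_K by (simp add: verts)

lemma p_eq_iff: "i < n \<Longrightarrow> j < n \<Longrightarrow> p i = p j \<longleftrightarrow> i = j"
  using inj_p by (auto simp: inj_on_def)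

lemma p_neq_K: "i < n \<Longrightarrow> x \<in> K \<Longrightarrow> p i \<noteq> x" "i < n \<Longrightarrow> x \<in> K \<Longrightarrow> x \<noteq> p i"
  using p_notin_K by auto

lemma arcs_simps:
  "x \<in> K \<Longrightarrow> y \<in> K \<Longrightarrow> (x, y) \<in> parcs G \<longleftrightarrow> x \<noteq> y"
  "i < n \<Longrightarrow> j < n \<Longrightarrow> (p i, p j) \<in> parcs G \<longleftrightarrow> j = i + 1 \<or> i = j + 1"
  "x \<in> K \<Longrightarrow> i < n \<Longrightarrow> (x, p i) \<in> parcs G \<longleftrightarrow> x = a \<and> i = 0"
  "x \<in> K \<Longrightarrow> i < n \<Longrightarrow> (p i, x) \<in> parcs G \<longleftrightarrow> x = a \<and> i = 0"
  using a_in_K n_pos by (auto simp: arcs p_eq_iff p_neq_K p_notin_K)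

section \<open>Frontiers of the three kinds of connected sets, then the counts they lead to\<close>

abbreviation count :: "'a set \<Rightarrow> nat" where
  "count S \<equiv> card (completions G S)"

lemma frontier_bridge:
  assumes "a \<in> A" "A \<subseteq> K" "y \<le> n"
  shows "frontier G (A \<union> p ` {..<y}) = (K - A) \<union> (if y < n then {p y} else {})"
proof -
  have K: "w \<in> frontier G (A \<union> p ` {..<y}) \<longleftrightarrow> w \<notin> A" if "w \<in> K" for w
  proof -
    have "w \<notin> p ` {..<y}"
      using that assms(3) p_notin_K by auto
    then show ?thesis
      using that assms a_in_K
      by (auto simp: frontier_def verts arcs_simps intro!: bexI[of _ a])
  qed
  have P: "p i \<in> frontier G (A \<union> p ` {..<y}) \<longleftrightarrow> i = y" if "i < n" for i
  proof
    assume "p i \<in> frontier G (A \<union> p ` {..<y})"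
    then have notin: "p i \<notin> p ` {..<y}" and "A \<union> p ` {..<y} = {} \<or> (\<exists>u\<in>A \<union> p ` {..<y}. (u, p i) \<in> parcs G)"
      by (auto simp: frontier_def)
    then obtain u where u: "u \<in> A \<union> p ` {..<y}" "(u, p i) \<in> parcs G"
      using assms by auto
    have "\<not> i < y" using notin by auto
    with u that assms show "i = y"
      by (auto simp: arcs_simps subset_iff)
  next
    assume i: "i = y"
    have "\<exists>u\<in>A \<union> p ` {..<y}. (u, p i) \<in> parcs G"
    \<comment> \<open>The earlier neighbour is the bridge end \<open>a\<close> for
      \<open>y = 0\<close> and the preceding path vertex otherwise.\<close>
    proof (cases y)
      case 0
      then show ?thesis using i assms n_pos a_in_K by (auto simp: arcs_simps intro!: bexI[of _ a])
    next
      case (Suc j)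
      then show ?thesis using i that by (intro bexI[of _ "p j"]) (auto simp: arcs_simps)
    qed
    moreover have "p i \<notin> A \<union> p ` {..<y}"
      using i that assms p_notin_K by (auto simp: p_eq_iff)
    ultimately show "p i \<in> frontier G (A \<union> p ` {..<y})"
      using that by (auto simp: frontier_def verts)
  qed
  show ?thesis
  proof (intro set_eqI)
    fix w
    consider "w \<in> K" | i where "i < n" "w = p i" | "w \<notin> pverts G"
      by (auto simp: verts)
    then show "w \<in> frontier G (A \<union> p ` {..<y}) \<longleftrightarrow> w \<in> (K - A) \<union> (if y < n then {p y} else {})"
    proof cases
      case 1 then show ?thesis using K by (auto simp: p_neq_K)
    next
      case 2 then show ?thesis using P p_notin_K by (auto simp: p_eq_iff)
    next
      case 3 then show ?thesis using frontier_subset[of G] by (auto simp: verts)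
    qed
  qed
qed

text \<open>The bridge is the only edge between clique and path, so without \<open>a\<close> no path
  vertex can be reached.\<close>

lemma frontier_clique:
  assumes "A \<subseteq> K - {a}" "A \<noteq> {}"
  shows "frontier G A = K - A"
proof -
  have "w \<in> frontier G A \<longleftrightarrow> w \<notin> A" if "w \<in> K" for w
  proof -
    obtain x where "x \<in> A" using assms by auto
    then show ?thesis
      using that assms
      by (auto simp: frontier_def verts subset_iff arcs_simps intro!: bexI[of _ x])
  qed
  moreover have "w \<notin> frontier G A" if "w \<notin> K" for w
    using that assms by (auto simp: frontier_def verts arcs_simps subset_iff)
  ultimately show ?thesis by blast
qed

lemma frontier_segment:
  assumes "i < j" "j \<le> n"
  shows "frontier G (p ` {i..<j}) = (if j < n then {p j} else {}) \<union> (if i = 0 then {a} else {p (i - 1)})"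
proof -
  have ne: "p ` {i..<j} \<noteq> {}" using assms by auto
  have K: "w \<in> frontier G (p ` {i..<j}) \<longleftrightarrow> i = 0 \<and> w = a" if "w \<in> K" for w
  proof -
    have "(\<exists>u\<in>p ` {i..<j}. (u, w) \<in> parcs G) \<longleftrightarrow> i = 0 \<and> w = a"
      using that assms by (auto simp: arcs_simps intro!: bexI[of _ 0])
    moreover have "w \<notin> p ` {i..<j}" using that assms p_notin_K by fastforce
    ultimately show ?thesis using that ne by (auto simp: frontier_def verts)
  qed
  have P: "p k \<in> frontier G (p ` {i..<j}) \<longleftrightarrow> k = j \<or> k + 1 = i" if "k < n" for k
  proof -
    have "(\<exists>u\<in>p ` {i..<j}. (u, p k) \<in> parcs G) \<longleftrightarrow> (\<exists>h\<in>{i..<j}. k = h + 1 \<or> h = k + 1)"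
      using that assms by (auto simp: arcs_simps)
    moreover have "p k \<notin> p ` {i..<j} \<longleftrightarrow> k \<notin> {i..<j}"
      using that assms by (auto simp: p_eq_iff)
    \<comment> \<open>Only the ends of a segment have path neighbours outside it:
      \<open>j - 1\<close> is next to \<open>j\<close>, and \<open>i\<close> is next to
      \<open>i - 1\<close>.\<close>
    moreover have "(\<exists>h\<in>{i..<j}. k = h + 1 \<or> h = k + 1) \<and> k \<notin> {i..<j} \<longleftrightarrow> k = j \<or> k + 1 = i"
      using assms by (auto intro: bexI[of _ "j - 1"] bexI[of _ i])
    ultimately show ?thesis
      using that ne unfolding frontier_def verts by auto
  qed
  show ?thesis
  proof (intro set_eqI)
    fix w
    consider "w \<in> K" | k where "k < n" "w = p k" | "w \<notin> pverts G"
      by (auto simp: verts)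
    then show "w \<in> frontier G (p ` {i..<j})
        \<longleftrightarrow> w \<in> (if j < n then {p j} else {}) \<union> (if i = 0 then {a} else {p (i - 1)})"
    proof cases
      case 1 then show ?thesis using K assms by (auto simp: p_neq_K)
    next
      case 2 then show ?thesis using P assms a_in_K p_notin_K by (auto simp: p_eq_iff)
    next
      case 3 then show ?thesis
        using frontier_subset[of G] assms a_in_K by (auto simp: verts)
    qed
  qed
qed

text \<open>The remaining path vertices come in a forced order and the remaining clique vertices in
  any order, interleaved freely: choose the positions of the former and permute the latter. The
  induction is on the number of vertices left.\<close>

lemma count_bridge:
  assumes "a \<in> A" "A \<subseteq> K" "y \<le> n"
  shows "count (A \<union> p ` {..<y}) =
    fact (card (K - A)) * ((card (K - A) + (n - y)) choose (n - y))"
  using assms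
proof (induction "card (K - A) + (n - y)" arbitrary: A y rule: less_induct)
  case less
  let ?S = "A \<union> p ` {..<y}"
  define r where "r = card (K - A)"
  have finKA: "finite (K - A)" using finite_K by simp
  show ?case
  proof (cases "A = K \<and> y = n")
    case True
    then show ?thesis using card_completions_full[of G] by (simp add: verts)
  next
    case False
    \<comment> \<open>\<open>K\<close> separates the two parts of the union, so equality would force
      \<open>A = K\<close> and, by injectivity of \<open>p\<close>, also
      \<open>y = n\<close>.\<close>
    have "?S \<noteq> pverts G"
    proof
      assume S: "?S = pverts G"
      have "p ` {..<n} \<inter> K = {}" "p ` {..<y} \<inter> K = {}"
        using p_notin_K less.prems(3) by auto
      then have "A = ?S \<inter> K" "p ` {..<y} = ?S - K"
        using less.prems(2) by auto
      moreover have "K = pverts G \<inter> K" "p ` {..<n} = pverts G - K"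
        using \<open>p ` {..<n} \<inter> K = {}\<close> by (auto simp: verts)
      ultimately have "A = K" "p ` {..<y} = p ` {..<n}"
        using S by simp_all
      moreover from this have "card {..<y} = card {..<n}"
        using less.prems(3) inj_on_subset[OF inj_p, of "{..<y}"] card_image[OF inj_p]
        by (metis card_image lessThan_subset_iff)
      ultimately show False using False by simp
    qed
    then have step: "count ?S = (\<Sum>w\<in>frontier G ?S. count (insert w ?S))"
      by (rule card_completions_step[OF finite_verts])
    have clique: "count (insert w ?S) = fact (r - 1) * ((r - 1 + (n - y)) choose (n - y))"
      if w: "w \<in> K - A" for w
    proof -
      have c: "card (K - insert w A) = r - 1" "r > 0"
        using w finKA by (auto simp: r_def card_gt_0_iff Diff_insert[of K w A])
      then have "card (K - insert w A) + (n - y) < card (K - A) + (n - y)"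
        by (simp add: r_def)
      from less.hyps[OF this] show ?thesis
        using less.prems w c by simp
    qed
    have path: "count (insert (p y) ?S) = fact r * ((r + (n - Suc y)) choose (n - Suc y))"
      if "y < n"
    proof -
      have "insert (p y) ?S = A \<union> p ` {..<Suc y}"
        by (simp add: lessThan_Suc)
      then show ?thesis
        using less.hyps[of A "Suc y"] less.prems that by (simp add: r_def)
    qed
    have sum_clique: "(\<Sum>w\<in>K - A. count (insert w ?S))
        = r * (fact (r - 1) * ((r - 1 + (n - y)) choose (n - y)))"
      using clique by (simp add: r_def)
    show ?thesis
    proof (cases "y < n")
      case True
      then obtain s where s: "n - y = Suc s" by (metis Suc_diff_Suc)
      then have s': "n - Suc y = s" by simp
      have "count ?S = (\<Sum>w\<in>K - A. count (insert w ?S)) + count (insert (p y) ?S)"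
        using True finKA p_notin_K
        by (simp add: step frontier_bridge[OF less.prems] sum.insert_if)
      \<comment> \<open>Pascal's rule. For \<open>r = 0\<close> the factor \<open>r\<close> makes
        the truncated \<open>r - 1\<close> harmless.\<close>
      also have "\<dots> = fact r * ((r + Suc s) choose Suc s)"
        unfolding sum_clique path[OF True] s s'
        by (cases r) (simp_all add: algebra_simps)
      finally show ?thesis unfolding r_def s .
    next
      case y: False
      then have "r > 0"
        using False less.prems finKA by (auto simp: r_def card_gt_0_iff)
      then have "r * fact (r - 1) = (fact r :: nat)"
        by (simp add: fact_reduce)
      then show ?thesis
        using y sum_clique by (simp add: step frontier_bridge[OF less.prems] r_def)
    qed
  qed
qed

text \<open>Here \<open>a\<close> must precede the whole path, so \<open>a\<close> and the path form
  a forced chain of \<open>n + 1\<close> vertices, interleaved with the other remaining clique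
  vertices in any order.\<close>

lemma count_clique:
  assumes "A \<subseteq> K - {a}" "A \<noteq> {}"
  shows "count A = fact (card (K - A) - 1) * ((card (K - A) + n) choose (n + 1))"
  using assms
proof (induction "card (K - A)" arbitrary: A rule: less_induct)
  case less
  define B where "B = K - A - {a}"
  define r where "r = card B"
  have finB: "finite B" using finite_K by (simp add: B_def)
  have KA: "K - A = insert a B" "a \<notin> B"
    using less.prems a_in_K by (auto simp: B_def)
  then have card_KA: "card (K - A) = Suc r"
    using finB by (simp add: r_def)
  have "A \<noteq> pverts G" using less.prems a_in_K by (auto simp: verts)
  then have "count A = (\<Sum>w\<in>K - A. count (insert w A))"
    by (simp add: card_completions_step[OF finite_verts] frontier_clique[OF less.prems])
  also have "\<dots> = count (insert a A) + (\<Sum>w\<in>B. count (insert w A))"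
    using KA finB by simp
  also have "count (insert a A) = fact r * ((r + n) choose n)"
  proof -
    have "K - insert a A = B" by (auto simp: B_def)
    then show ?thesis
      using count_bridge[of "insert a A" 0] less.prems a_in_K by (auto simp: r_def)
  qed
  also have "(\<Sum>w\<in>B. count (insert w A)) = (\<Sum>w\<in>B. fact (r - 1) * ((r + n) choose (n + 1)))"
  proof (rule sum.cong[OF refl])
    fix w assume w: "w \<in> B"
    then have c: "card (K - insert w A) = r"
      using card_KA finite_K by (auto simp: Diff_insert[of K w A] B_def)
    then show "count (insert w A) = fact (r - 1) * ((r + n) choose (n + 1))"
      using less.hyps[of "insert w A"] less.prems w card_KA by (auto simp: B_def)
  qed
  also have "\<dots> = r * (fact (r - 1) * ((r + n) choose (n + 1)))"
    by (simp add: r_def)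
  also have "fact r * ((r + n) choose n) + \<dots> = fact r * ((Suc r + n) choose (n + 1))"
    by (cases r) (simp_all add: algebra_simps)
  finally show ?case by (simp add: card_KA)
qed

text \<open>To the left come \<open>i\<close> path vertices, then \<open>a\<close>, then the other
  clique vertices in any order; to the right, \<open>n - j\<close> path vertices in a fixed order.
  The two sequences interleave freely.\<close>

lemma count_segment:
  assumes "i < j" "j \<le> n"
  shows "count (p ` {i..<j}) = fact (card K - 1) * ((i + card K + (n - j)) choose (n - j))"
  using assms
proof (induction "i + (n - j)" arbitrary: i j rule: less_induct)
  case less
  have ne: "p ` {i..<j} \<noteq> pverts G"
  proof -
    have "a \<notin> p ` {i..<j}" using a_in_K p_notin_K less.prems by fastforce
    then show ?thesis using a_in_K by (auto simp: verts)
  qed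
  have m: "card K > 0" using a_in_K finite_K by (auto simp: card_gt_0_iff)
  let ?x = "if i = 0 then a else p (i - 1)"
  \<comment> \<open>For \<open>i = 0\<close> the enlarged set contains \<open>a\<close>, so
    \<open>count_bridge\<close> applies; otherwise it is a longer segment, covered by
    induction.\<close>
  have left: "count (insert ?x (p ` {i..<j}))
      = fact (card K - 1) * ((i + card K - 1 + (n - j)) choose (n - j))"
  proof (cases i)
    case 0
    then show ?thesis
      using count_bridge[of "{a}" j] a_in_K finite_K less.prems
      by (simp add: atLeast0LessThan)
  next
    case (Suc h)
    have "{h..<j} = insert h {i..<j}" using Suc less.prems by auto
    then have "insert ?x (p ` {i..<j}) = p ` {h..<j}" using Suc by simp
    then show ?thesis using less.hyps[of h j] less.prems Suc by simp
  qed
  have step: "count (p ` {i..<j}) = (\<Sum>w\<in>(if j < n then {p j} else {}) \<union> {?x}. count (insert w (p ` {i..<j})))"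
    using card_completions_step[OF finite_verts ne] unfolding frontier_segment[OF less.prems]
    by (cases "i = 0") simp_all
  show ?case
  proof (cases "j < n")
    case True
    then obtain s where s: "n - j = Suc s" by (metis Suc_diff_Suc)
    then have s': "n - Suc j = s" by simp
    have "{i..<Suc j} = insert j {i..<j}" using less.prems by auto
    then have right: "count (insert (p j) (p ` {i..<j})) = fact (card K - 1) * ((i + card K + s) choose s)"
      using less.hyps[of i "Suc j", unfolded s s'] less.prems True by (simp flip: image_insert)
    have "p j \<noteq> ?x" using True less.prems p_notin_K a_in_K by (auto simp: p_eq_iff)
    then have "count (p ` {i..<j})
        = count (insert (p j) (p ` {i..<j})) + count (insert ?x (p ` {i..<j}))"
      using True step by simp
    also have "\<dots> = fact (card K - 1) * ((i + card K + Suc s) choose Suc s)"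
      unfolding left right s using m by (cases "card K") (simp_all add: algebra_simps)
    finally show ?thesis unfolding s .
  next
    case False
    then show ?thesis using step left less.prems by simp
  qed
qed

text \<open>The completions are sorted by their first vertex: starts in the clique combine, by
  Pascal's rule, to the first binomial, and each start \<open>p k\<close> gives one summand.\<close>

theorem count_empty:
  "count {} = fact (card K - 1) *
    (((card K + n) choose (n + 1)) + (\<Sum>k<n. (card K + n - 1) choose (k + card K)))"
proof -
  define r where "r = card (K - {a})"
  have m: "card K = Suc r"
    using a_in_K finite_K by (simp add: r_def card.remove[of K a] del: card_Diff_insert)
  have "frontier G {} = pverts G" "{} \<noteq> pverts G"
    using a_in_K by (auto simp: frontier_def verts)
  then have "count {} = (\<Sum>w\<in>K \<union> p ` {..<n}. count {w})"
    using card_completions_step[OF finite_verts, of "{}"] unfolding verts by simp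
  also have "\<dots> = (\<Sum>w\<in>K. count {w}) + (\<Sum>w\<in>p ` {..<n}. count {w})"
    using finite_K p_notin_K by (intro sum.union_disjoint) auto
  also have "(\<Sum>w\<in>K. count {w}) = count {a} + (\<Sum>w\<in>K - {a}. count {w})"
    using finite_K a_in_K by (rule sum.remove)
  also have "count {a} = fact r * ((r + n) choose n)"
    using count_bridge[of "{a}" 0] a_in_K by (simp add: r_def)
  also have "(\<Sum>w\<in>K - {a}. count {w}) = (\<Sum>w\<in>K - {a}. fact (r - 1) * ((r + n) choose (n + 1)))"
  proof (rule sum.cong[OF refl])
    fix w assume "w \<in> K - {a}"
    moreover from this have "card (K - {w}) = r" using m by simp
    ultimately show "count {w} = fact (r - 1) * ((r + n) choose (n + 1))"
      using count_clique[of "{w}"] by simp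
  qed
  also have "\<dots> = r * (fact (r - 1) * ((r + n) choose (n + 1)))"
    by (simp add: r_def)
  also have "fact r * ((r + n) choose n) + \<dots> = fact r * ((card K + n) choose (n + 1))"
    unfolding m by (cases r) (simp_all add: algebra_simps)
  also have "(\<Sum>w\<in>p ` {..<n}. count {w}) = (\<Sum>k<n. count {p k})"
    using inj_p by (simp add: sum.reindex)
  also have "\<dots> = (\<Sum>k<n. fact r * ((card K + n - 1) choose (k + card K)))"
  proof (rule sum.cong[OF refl])
    fix k assume "k \<in> {..<n}"
    then have k: "k < n" by simp
    have "count {p k} = fact r * ((k + card K + (n - Suc k)) choose (n - Suc k))"
      using count_segment[of k "Suc k"] k m by simp
    \<comment> \<open>Symmetry replaces the number of path vertices beyond \<open>p k\<close> by the
      complementary lower index of the closed form.\<close>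
    also have "(k + card K + (n - Suc k)) choose (n - Suc k)
        = (k + card K + (n - Suc k)) choose (k + card K)"
      by (subst binomial_symmetric) simp_all
    also have "k + card K + (n - Suc k) = card K + n - 1"
      using k by simp
    finally show "count {p k} = fact r * ((card K + n - 1) choose (k + card K))" .
  qed
  finally show ?thesis
    by (simp add: m sum_distrib_left distrib_left)
qed

end

section \<open>The concrete lollipop as an instance of the locale\<close>

lemma lollipop_graph_lollipop:
  assumes "a < m" "n \<ge> 1" "b \<in> path_ends n"
  shows "lollipop_graph (lollipop m n a b) (Inl ` {..<m}) (Inl a)
    (\<lambda>k. Inr (if b = 0 then k else n - 1 - k)) n"
proof
  \<comment> \<open>A bridge at the far end \<open>n - 1\<close> makes the numbering run backwards;
    for \<open>n = 1\<close> both ends coincide.\<close>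
  let ?p = "\<lambda>k. Inr (if b = 0 then k else n - 1 - k) :: nat + nat"
  have b: "b = 0 \<or> b = n - 1" using assms(3) by (simp add: path_ends_def)
  have img: "?p ` {..<n} = Inr ` {..<n}"
  proof (intro equalityI subsetI)
    fix x :: "nat + nat" assume "x \<in> Inr ` {..<n}"
    then obtain k where "k < n" "x = Inr k" by auto
    \<comment> \<open>The numbering is an involution on indices below \<open>n\<close>, so it
      supplies its own preimages.\<close>
    then show "x \<in> ?p ` {..<n}"
      by (intro image_eqI[of _ _ "if b = 0 then k else n - 1 - k"]) auto
  qed (use assms in auto)
  show "pverts (lollipop m n a b) = Inl ` {..<m} \<union> ?p ` {..<n}"
    unfolding img
    by (auto simp: lollipop_def add_edge_def disjoint_union_def complete_graph_def path_graph_def)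
  show "inj_on ?p {..<n}" by (auto simp: inj_on_def)
  fix x y
  \<comment> \<open>Reversal preserves consecutiveness, so either numbering describes the same path
    arcs.\<close>
  have path: "(\<exists>i j. i < n \<and> j < n \<and> (j = i + 1 \<or> i = j + 1) \<and> x = ?p i \<and> y = ?p j)
      \<longleftrightarrow> (\<exists>i j. i < n \<and> j < n \<and> (j = i + 1 \<or> i = j + 1) \<and> x = Inr i \<and> y = Inr j)"
    (is "?L \<longleftrightarrow> ?R")
  proof
    assume ?L
    then obtain i j where "i < n" "j < n" "j = i + 1 \<or> i = j + 1" "x = ?p i" "y = ?p j" by blast
    then show ?R by auto
  next
    assume ?R
    then obtain i j where "i < n" "j < n" "j = i + 1 \<or> i = j + 1" "x = Inr i" "y = Inr j" by blast
    then show ?L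
      by (intro exI[of _ "if b = 0 then i else n - 1 - i"] exI[of _ "if b = 0 then j else n - 1 - j"])
        auto
  qed
  have "Inr b = ?p 0" using b by auto
  then show "(x, y) \<in> parcs (lollipop m n a b) \<longleftrightarrow>
    x \<in> Inl ` {..<m} \<and> y \<in> Inl ` {..<m} \<and> x \<noteq> y
    \<or> (\<exists>i j. i < n \<and> j < n \<and> (j = i + 1 \<or> i = j + 1) \<and> x = ?p i \<and> y = ?p j)
    \<or> (x, y) = (Inl a, ?p 0) \<or> (x, y) = (?p 0, Inl a)"
    unfolding path
    by (cases x; cases y)
      (auto simp: lollipop_def add_edge_def disjoint_union_def complete_graph_def path_graph_def
        image_iff)
qed (use assms in auto)

theorem theorem5:
  fixes m n a b :: nat
  assumes "m \<ge> 1" and "n \<ge> 1"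
    and "a \<in> pverts (complete_graph m)" and "b \<in> path_ends n"
  shows "\<L> (lollipop m n a b) =
    fact (m - 1) * (((m + n) choose (n + 1)) + (\<Sum>k=0..n-1. (m + n - 1) choose (k + m)))"
proof -
  let ?G = "lollipop m n a b"
  interpret pair_graph ?G
    by (rule pair_graph_lollipop) (use assms in auto)
  have "a < m" using assms(3) by (simp add: complete_graph_def)
  then interpret lollipop_graph ?G "Inl ` {..<m}" "Inl a"
    "\<lambda>k. Inr (if b = 0 then k else n - 1 - k)" n
    by (rule lollipop_graph_lollipop) (use assms in auto)
  have "parcs ?G \<subseteq> pverts ?G \<times> pverts ?G"
    using in_arcsD1 in_arcsD2 by auto
  moreover have "sym (parcs ?G)"
    using sym_arcs by (simp add: symmetric_def)
  moreover have "pverts ?G \<noteq> {}"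
    using a_in_K by (auto simp: verts)
  ultimately have "\<L> ?G = count {}"
    by (rule num_rw_labelings_eq_card_completions)
  \<comment> \<open>This needs \<open>n \<ge> 1\<close>: for \<open>n = 0\<close> truncated
    subtraction would leave the index \<open>0\<close> on the left.\<close>
  moreover have "{0..n - 1} = {..<n}" using assms(2) by auto
  ultimately show ?thesis
    using count_empty by (simp add: card_image)
qed

end
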